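(* For any subset $A\subseteq\mathbb{N}$: (i) $A$ is finite if, and only if, $\mathrm{Cont}_{\mathbb{E}}(A)=\emptyset$. (ii) $A$ is cofinite if, and only if, $\mathrm{Cont}_{\mathbb{E}}(A)\in\mathbf{J}_{\neg\neg}(\mathbb{E})$.
   Context: $\mathbb{E}$ is the monoid, under composition, of all strictly increasing (i.e. monotone and injective) maps $u:\mathbb{N}\to\mathbb{N}$. An ideal of $\mathbb{E}$ is a right ideal: a (possibly empty) subset $I\subseteq\mathbb{E}$ such that $u\in I$ and $v\in\mathbb{E}$ imply $u\circ v\in I$. For $A\subseteq\mathbb{N}$, $\mathrm{Cont}_{\mathbb{E}}(A)=\{u\in\mathbb{E};\ \mathrm{Im}(u)\subseteq A\}$, which is an ideal of $\mathbb{E}$. The double negation topology on $\mathbb{E}$ is $$\mathbf{J}_{\neg\neg}(\mathbb{E})=\{I\text{ ideal of }\mathbb{E};\ \forall u\in\mathbb{E},\ \exists v\in\mathbb{E},\ u\circ v\in I\}.$$ A subset of $\mathbb{N}$ is cofinite if its complement in $\mathbb{N}$ is finite. *)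

theory Defs
  imports Main
begin

definition EE :: "(nat \<Rightarrow> nat) set" where
  "EE = {u. strict_mono u}"

(* Closed under precomposition, i.e. a right ideal; the empty set is allowed. *)
definition ideal_EE :: "(nat \<Rightarrow> nat) set \<Rightarrow> bool" where
  "ideal_EE I \<longleftrightarrow> I \<subseteq> EE \<and> (\<forall>u\<in>I. \<forall>v\<in>EE. u \<circ> v \<in> I)"

definition Cont_EE :: "nat set \<Rightarrow> (nat \<Rightarrow> nat) set" where
  "Cont_EE A = {u \<in> EE. range u \<subseteq> A}"

definition J_notnot_EE :: "(nat \<Rightarrow> nat) set set" where
  "J_notnot_EE = {I. ideal_EE I \<and> (\<forall>u\<in>EE. \<exists>v\<in>EE. u \<circ> v \<in> I)}"

lemma EE_iff_mono_inj: "u \<in> EE \<longleftrightarrow> mono u \<and> inj u"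
  by (auto simp: EE_def strict_mono_iff_mono)

lemma ideal_Cont_EE: "ideal_EE (Cont_EE A)"
  by (auto simp: ideal_EE_def Cont_EE_def EE_def strict_mono_def)

definition cofinite_nat :: "nat set \<Rightarrow> bool" where
  "cofinite_nat A \<longleftrightarrow> finite (UNIV - A)"

end

theory Submission
  imports Defs "HOL-Library.Infinite_Set"
begin

text \<open>The first equivalence holds because every infinite set of naturals has a strictly increasing
  enumeration. The second reduces to the first: \<open>u \<circ> v\<close> lands in \<open>A\<close> exactly when \<open>v\<close> lands in
  the preimage \<open>u -` A\<close>, so \<open>Cont_EE A\<close> is dense in the double negation sense iff every
  preimage \<open>u -` A\<close> along a strictly increasing map is infinite. Preimages of a
  cofinite set under injective maps are cofinite. If \<open>A\<close> is not cofinite, an increasing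
  enumeration \<open>u\<close> of elements outside \<open>A\<close> has empty preimage \<open>u -` A\<close>.\<close>

lemma Cont_EE_empty_iff_finite: "Cont_EE A = {} \<longleftrightarrow> finite A"
proof
  assume empty: "Cont_EE A = {}"
  show "finite A"
  proof (rule ccontr)
    assume "infinite A"
    then obtain r :: "nat \<Rightarrow> nat" where "strict_mono r" "\<forall>n. r n \<in> A"
      using infinite_enumerate by blast
    then have "r \<in> Cont_EE A"
      by (auto simp: Cont_EE_def EE_def)
    with empty show False by simp
  qed
next
  assume "finite A"
  then show "Cont_EE A = {}"
    by (auto simp: Cont_EE_def EE_iff_mono_inj dest: finite_subset range_inj_infinite)
qed

lemma comp_mem_Cont_EE_iff:
  assumes "u \<in> EE" "v \<in> EE"
  shows "u \<circ> v \<in> Cont_EE A \<longleftrightarrow> v \<in> Cont_EE (u -` A)"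
  using assms by (auto simp: Cont_EE_def EE_def strict_mono_def)

lemma Cont_EE_mem_J_notnot_iff:
  "Cont_EE A \<in> J_notnot_EE \<longleftrightarrow> (\<forall>u\<in>EE. infinite (u -` A))"
proof -
  have "(\<exists>v\<in>EE. u \<circ> v \<in> Cont_EE A) \<longleftrightarrow> infinite (u -` A)" if u: "u \<in> EE" for u
  proof -
    have "(\<exists>v\<in>EE. u \<circ> v \<in> Cont_EE A) \<longleftrightarrow> (\<exists>v\<in>EE. v \<in> Cont_EE (u -` A))"
      using comp_mem_Cont_EE_iff[OF u] by blast
    also have "\<dots> \<longleftrightarrow> Cont_EE (u -` A) \<noteq> {}"
      by (auto simp: Cont_EE_def)
    finally show ?thesis
      by (simp add: Cont_EE_empty_iff_finite)
  qed
  then show ?thesis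
    by (simp add: J_notnot_EE_def ideal_Cont_EE)
qed

lemma cofinite_nat_iff_infinite_preimages:
  "cofinite_nat A \<longleftrightarrow> (\<forall>u\<in>EE. infinite (u -` A))"
proof
  assume cof: "cofinite_nat A"
  show "\<forall>u\<in>EE. infinite (u -` A)"
  proof
    fix u assume "u \<in> EE"
    then have "finite (u -` (- A))"
      using cof by (auto simp: cofinite_nat_def EE_iff_mono_inj Compl_eq_Diff_UNIV
          intro: finite_vimageI)
    then show "infinite (u -` A)"
      by (metis finite_Un infinite_UNIV_nat vimage_Un vimage_UNIV Compl_partition2 sup_compl_top)
  qed
next
  assume preimages: "\<forall>u\<in>EE. infinite (u -` A)"
  show "cofinite_nat A"
  proof (rule ccontr)
    assume "\<not> cofinite_nat A"
    then obtain r :: "nat \<Rightarrow> nat" where r: "strict_mono r" "\<forall>n. r n \<in> UNIV - A"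
      using infinite_enumerate unfolding cofinite_nat_def by blast
    then have "r -` A = {}" by auto
    with r(1) preimages show False
      by (force simp: EE_def)
  qed
qed

theorem corollary2p16:
  fixes A :: "nat set"
  shows "(finite A \<longleftrightarrow> Cont_EE A = {}) \<and>
         (cofinite_nat A \<longleftrightarrow> Cont_EE A \<in> J_notnot_EE)"
  by (simp add: Cont_EE_empty_iff_finite cofinite_nat_iff_infinite_preimages
      Cont_EE_mem_J_notnot_iff)

end
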